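(* Let $f$ be the indicator function of an interval $I\subset\mathbb{T}$. Let $\omega$ be a point configuration on $\mathbb{Z}$ with law $\mathbb{P}^f$. Then there exists a measurable function $$N:\{\text{point configurations on }\mathbb{Z}\setminus\{\mathbf{0}\}\}\to\mathbb{N}\cup\{0\}$$ such that almost surely $\omega(\mathbf{0})=N(\omega_{\mathrm{out}})$. Consequently, the events $\{\mathbb{P}[\omega(\mathbf{0})=1\mid\omega_{\mathrm{out}}]=0\}$ and $\{\mathbb{P}[\omega(\mathbf{0})=0\mid\omega_{\mathrm{out}}]=0\}$ both have positive probability (in $\omega_{\mathrm{out}}$).
   Context: $\mathbb{T}=[0,1]$ with endpoints identified (the circle). For a measurable $f:\mathbb{T}\to[0,1]$, multiplication by $f$ is a non-negative contraction on $L^2(\mathbb{T})$; under Fourier conjugation it becomes a non-negative contraction on $\ell^2(\mathbb{Z})$ with matrix entries $\hat f(i-j)$, where $\hat f(k)=\int_0^1 f(x)e^{-2\pi i kx}\,dx$. $\mathbb{P}^f$ denotes the law of the associated determinantal point process on $\mathbb{Z}$, i.e. the random subset of $\mathbb{Z}$ such that for all distinct $k_1,\dots,k_n\in\mathbb{Z}$ the probability that $k_1,\dots,k_n$ all belong to it is $\det\left(\hat f(k_i-k_j)\right)_{i,j=1}^n$. For a configuration $\omega$ on $\mathbb{Z}$, $\omega(k)$ is the indicator of having a point at $k$, $\mathbf{0}$ is the origin, and $\omega_{\mathrm{out}}$ is the restriction of $\omega$ to $\mathbb{Z}\setminus\{\mathbf{0}\}$.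
   Formalization: The final claim, that both events have positive probability, is stated only for intervals I of length strictly between 0 and 1; it fails when I has length 0 or 1, since then ω(0) is almost surely constant. *)

theory Defs
  imports "HOL-Probability.Probability" "Jordan_Normal_Form.Determinant"
begin

text \<open>
  The circle is [0,1] with endpoints identified, carrying Lebesgue measure; functions on it are
  functions on the reals of which only the values on [0,1] matter. An interval of the circle is the
  image of an interval of the real line under reduction modulo 1. It may therefore wrap around the
  point 0 = 1, and the empty arc, single points and the whole circle are included.
\<close>

definition circle_interval :: "real set \<Rightarrow> bool" where
  "circle_interval I \<longleftrightarrow>
     (\<exists>J. is_interval J \<and> I = {x \<in> {0..1}. \<exists>n::int. x + of_int n \<in> J})"

definition fourier_coeff :: "(real \<Rightarrow> real) \<Rightarrow> int \<Rightarrow> complex" where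
  "fourier_coeff f k =
     (LINT x:{0..1}|lborel. complex_of_real (f x) * exp (- 2 * of_real pi * \<i> * of_int k * of_real x))"

text \<open>
  A point configuration on a set \<open>S\<close> of integers is given by its occupation indicators
  \<open>k \<mapsto> \<omega> k\<close>, extensional outside \<open>S\<close>.
\<close>

definition config_space :: "int set \<Rightarrow> (int \<Rightarrow> bool) measure" where
  "config_space S = PiM S (\<lambda>_. count_space UNIV)"

definition out_config :: "(int \<Rightarrow> bool) \<Rightarrow> int \<Rightarrow> bool" where
  "out_config \<omega> = restrict \<omega> (UNIV - {0})"

text \<open>
  \<open>determinantal_law f P\<close> says that \<open>P\<close> is the law \<open>P\<^sup>f\<close>. The inclusion probabilities of finite
  sets determine \<open>P\<close>, since the events they refer to form a generating pi-system. The name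
  \<open>det\<close> is qualified because HOL-Analysis has one for matrices with type-indexed dimension.
\<close>

definition determinantal_law :: "(real \<Rightarrow> real) \<Rightarrow> (int \<Rightarrow> bool) measure \<Rightarrow> bool" where
  "determinantal_law f P \<longleftrightarrow>
     prob_space P \<and> sets P = sets (config_space UNIV) \<and>
     (\<forall>ks. distinct ks \<longrightarrow>
        complex_of_real (measure P {\<omega> \<in> space P. \<forall>k \<in> set ks. \<omega> k}) =
        Determinant.det (mat (length ks) (length ks)
          (\<lambda>(i, j). fourier_coeff f (ks ! i - ks ! j))))"

text \<open>
  Conditional probability of the event \<open>A\<close> given the random element \<open>Y\<close> with values in \<open>S\<close>, as
  a random variable on \<open>M\<close>; it is determined up to null sets.
\<close>

definition cond_prob_given ::
    "'a measure \<Rightarrow> ('a \<Rightarrow> 'b) \<Rightarrow> 'b measure \<Rightarrow> 'a set \<Rightarrow> 'a \<Rightarrow> real" where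
  "cond_prob_given M Y S A = real_cond_exp M (vimage_algebra (space M) Y S) (indicator A)"

end

theory Submission imports Defs begin

text \<open>
  The covariance of the occupation indicators is \<open>Cov(\<omega>(j), \<omega>(k)) = \<integral> g(t) cos(2\<pi>(j - k)t) dt\<close> over
  \<open>[0,1]\<close>, where \<open>g\<close> is the trapezoid \<open>min(t, 1 - t, b)\<close> and \<open>b\<close> is the smaller of the measures of
  \<open>I\<close> and its complement. So a linear statistic \<open>\<Sum> \<phi>(k) \<omega>(k)\<close> has variance \<open>\<integral> g |\<Phi>|\<^sup>2\<close> with
  \<open>\<Phi>(t) = \<Sum> \<phi>(k) e(kt)\<close>. Choose \<open>\<Phi>\<close> to be the average of the Fejer kernels \<open>F\<^sub>N\<close> with
  \<open>N = 4\<^sup>i\<close>, \<open>i < m\<close>. From \<open>\<integral> F\<^sub>N = 1\<close>, \<open>F\<^sub>N \<le> N\<close> and \<open>F\<^sub>N sin\<^sup>2(\<pi>t) \<le> 1/N\<close> one gets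
  \<open>\<integral> g F\<^sub>N F\<^sub>M \<le> sqrt(N/M)\<close>, so these kernels are almost orthogonal and the variance is at most
  \<open>3/m\<close>, while \<open>\<phi>(0) = 1\<close>. Hence along a subsequence the centred statistics tend to 0 almost surely,
  which expresses \<open>\<omega>(0)\<close> as a limit of functions of the configuration outside the origin.
\<close>

subsection \<open>Fejer kernels\<close>

text \<open>Concavity puts the graph of sin(pi t) above its chord over [0, 1/2], and t -> 1 - t
  covers the other half. This trades a piecewise linear weight for a sine, whose square tames a
  Fejer kernel in \<open>fejer_sin_le\<close>.\<close>

lemma min_le_sin_pi:
  assumes "0 \<le> t" "t \<le> 1"
  shows "min t (1 - t) \<le> sin (pi * t)"
proof -
  have conc: "concave_on {0..1} (\<lambda>t. sin (pi * t))"
  proof (rule f''_le0_imp_concave)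
    show "((\<lambda>t. sin (pi * t)) has_real_derivative pi * cos (pi * x)) (at x)" for x
      by (auto intro!: derivative_eq_intros)
    show "((\<lambda>t. pi * cos (pi * t)) has_real_derivative - (pi\<^sup>2 * sin (pi * x))) (at x)" for x
      by (auto intro!: derivative_eq_intros simp: power2_eq_square)
    show "- (pi\<^sup>2 * sin (pi * x)) \<le> 0" if "x \<in> {0..1}" for x
      using that by (auto intro!: mult_nonneg_nonneg sin_ge_zero mult_left_le)
  qed simp
  have half: "s \<le> sin (pi * s)" if "0 \<le> s" "s \<le> 1/2" for s
  proof -
    have "(1 - 2 * s) * sin (pi * 0) + 2 * s * sin (pi * (1/2))
        \<le> sin (pi * ((1 - 2 * s) *\<^sub>R 0 + (2 * s) *\<^sub>R (1/2)))"
      using conc[unfolded concave_on_iff, THEN conjunct2, rule_format, of 0 "1/2" "1 - 2 * s" "2 * s"] that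
      by simp
    then show ?thesis using that by simp
  qed
  show ?thesis
  proof (cases "t \<le> 1/2")
    case True
    then show ?thesis using half[of t] assms by auto
  next
    case False
    have "sin (pi * (1 - t)) = sin (pi * t)"
      using sin_pi_minus[of "pi * t"] by (simp add: algebra_simps)
    then show ?thesis using half[of "1 - t"] assms False by auto
  qed
qed

lemma has_integral_cos_int:
  fixes k :: int
  shows "((\<lambda>t. cos (2 * pi * of_int k * t)) has_integral of_bool (k = 0)) {0..1}"
proof (cases "k = 0")
  case True
  then show ?thesis using has_integral_const_real[of "1::real" 0 1] by simp
next
  case False
  have "((\<lambda>t. cos (2 * pi * of_int k * t)) has_integral
      sin (2 * pi * of_int k * 1) / (2 * pi * of_int k) - sin (2 * pi * of_int k * 0) / (2 * pi * of_int k)) {0..1}"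
    using False
    by (intro fundamental_theorem_of_calculus)
       (auto intro!: derivative_eq_intros
         simp flip: has_real_derivative_iff_has_vector_derivative)
  moreover have "sin (2 * pi * of_int k) = 0"
    using sin_int_2pin[of k] by simp
  ultimately show ?thesis using False by simp
qed

text \<open>The frequencies start at 0 instead of being centred; the shift contributes a unimodular
  factor, which the modulus in \<open>fejer\<close> removes.\<close>

definition dirichlet :: "nat \<Rightarrow> real \<Rightarrow> complex" where
  "dirichlet N t = (\<Sum>j<N. cis (2 * pi * real j * t))"

definition fejer :: "nat \<Rightarrow> real \<Rightarrow> real" where
  "fejer N t = (cmod (dirichlet N t))\<^sup>2 / real N"

lemma continuous_on_fejer [continuous_intros]: "continuous_on S (fejer N)"
proof -
  have "continuous_on S (\<lambda>t. (cmod (\<Sum>j<N. cis (2 * pi * real j * t)))\<^sup>2 * inverse (real N))"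
    by (intro continuous_intros)
  then show ?thesis
    by (simp add: fejer_def[abs_def] dirichlet_def[abs_def] divide_inverse)
qed

lemma fejer_nonneg: "0 \<le> fejer N t"
  by (simp add: fejer_def)

lemma fejer_le: "fejer N t \<le> real N"
proof -
  have "cmod (dirichlet N t) \<le> real N"
    unfolding dirichlet_def using sum_norm_le[of "{..<N}" "\<lambda>j. cis (2 * pi * real j * t)" "\<lambda>_. 1"]
    by simp
  then have "(cmod (dirichlet N t))\<^sup>2 \<le> real N * real N"
    by (simp add: power2_eq_square mult_mono)
  then show ?thesis
    by (cases "N = 0") (simp_all add: fejer_def divide_simps)
qed

text \<open>With q = \<open>cis (2 * pi * t)\<close>, the factor 1 - q collapses the geometric sum
  to 1 - q^N, of modulus at most 2, while |1 - q| = 2 |sin(pi t)|.\<close>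

lemma fejer_sin_le: "fejer N t * (sin (pi * t))\<^sup>2 \<le> 1 / real N"
proof -
  have "dirichlet N t = (\<Sum>j<N. cis (2 * pi * t) ^ j)"
    unfolding dirichlet_def by (simp add: Complex.DeMoivre mult_ac)
  then have "(1 - cis (2 * pi * t)) * dirichlet N t = 1 - cis (2 * pi * t) ^ N"
    by (simp add: one_diff_power_eq)
  then have "cmod (1 - cis (2 * pi * t)) * cmod (dirichlet N t) = cmod (1 - cis (2 * pi * t) ^ N)"
    by (metis norm_mult)
  also have "\<dots> \<le> 2"
    using norm_triangle_ineq4[of 1 "cis (2 * pi * t) ^ N"] by (simp add: norm_power)
  finally have "(cmod (1 - cis (2 * pi * t)) * cmod (dirichlet N t))\<^sup>2 \<le> 2\<^sup>2"
    by (intro power_mono) auto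
  moreover have "(cmod (1 - cis (2 * pi * t)))\<^sup>2 = 4 * (sin (pi * t))\<^sup>2"
  proof -
    have c: "cos (2 * pi * t) = 1 - 2 * (sin (pi * t))\<^sup>2"
      using cos_double_sin[of "pi * t"] by (simp add: mult_ac)
    have "(cmod (1 - cis (2 * pi * t)))\<^sup>2 = (1 - cos (2 * pi * t))\<^sup>2 + (sin (2 * pi * t))\<^sup>2"
      by (simp add: cmod_power2)
    also have "\<dots> = 2 - 2 * cos (2 * pi * t)"
      using sin_cos_squared_add[of "2 * pi * t"] by (simp add: power2_eq_square algebra_simps)
    finally show ?thesis using c by simp
  qed
  ultimately have "(sin (pi * t))\<^sup>2 * (cmod (dirichlet N t))\<^sup>2 \<le> 1"
    by (simp add: power_mult_distrib)
  then have "((sin (pi * t))\<^sup>2 * (cmod (dirichlet N t))\<^sup>2) / real N \<le> 1 / real N"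
    by (intro divide_right_mono) auto
  then show ?thesis by (simp add: fejer_def mult_ac)
qed

text \<open>The squared modulus is the sum times its conjugate. Frequencies stay indexed by pairs
  and are not collected with weights N - |k|; \<open>fejer_stat\<close> has the same shape.\<close>

lemma fejer_eq_sum_cis:
  "complex_of_real (fejer N t) = (\<Sum>i<N. \<Sum>j<N. cis (2 * pi * of_int (int i - int j) * t)) / of_nat N"
proof -
  have "complex_of_real ((cmod (dirichlet N t))\<^sup>2) = dirichlet N t * cnj (dirichlet N t)"
    by (rule complex_norm_square)
  also have "\<dots> = (\<Sum>i<N. \<Sum>j<N. cis (2 * pi * real i * t) * cis (- (2 * pi * real j * t)))"
    by (simp add: dirichlet_def cis_cnj sum_product)
  also have "\<dots> = (\<Sum>i<N. \<Sum>j<N. cis (2 * pi * of_int (int i - int j) * t))"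
    by (simp add: cis_mult algebra_simps)
  finally show ?thesis by (simp add: fejer_def)
qed

lemma fejer_eq_sum_cos:
  "fejer N t = (\<Sum>i<N. \<Sum>j<N. cos (2 * pi * of_int (int i - int j) * t)) / real N"
proof -
  have "Re (complex_of_real (fejer N t)) = Re ((\<Sum>i<N. \<Sum>j<N. cis (2 * pi * of_int (int i - int j) * t)) / of_nat N)"
    by (simp only: fejer_eq_sum_cis)
  then show ?thesis by (simp add: Re_divide_of_nat)
qed

text \<open>Only the N diagonal pairs i = j carry a cosine of nonzero mean.\<close>

lemma fejer_has_integral:
  assumes "0 < N"
  shows "(fejer N has_integral 1) {0..1}"
proof -
  have "((\<lambda>t. (\<Sum>i<N. \<Sum>j<N. cos (2 * pi * of_int (int i - int j) * t)) / real N) has_integral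
      (\<Sum>i<N. \<Sum>j<N. of_bool (int i - int j = 0)) / real N) {0..1}"
    by (intro has_integral_divide has_integral_sum has_integral_cos_int) auto
  moreover have "(\<Sum>i<N. \<Sum>j<N. of_bool (int i - int j = 0) :: real) = real N"
    by (simp add: of_bool_def)
  ultimately show ?thesis using assms by (simp add: fejer_eq_sum_cos[abs_def])
qed

text \<open>The weight is at most sin(pi t), which is split into a constant and a multiple of
  sin^2(pi t). The constant part uses \<open>fejer_le\<close> for N, the other
  \<open>fejer_sin_le\<close> for M; each time the remaining kernel has integral 1. The bound is
  small when M is much larger than N.\<close>

lemma integral_fejer_fejer_le:
  assumes "0 < N" "0 < M" and cont: "continuous_on {0..1} g"
    and g: "\<And>t. 0 \<le> t \<Longrightarrow> t \<le> 1 \<Longrightarrow> g t \<le> min t (1 - t)"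
  shows "integral {0..1} (\<lambda>t. g t * (fejer N t * fejer M t)) \<le> sqrt (real N / real M)"
proof -
  define \<epsilon> where "\<epsilon> = 1 / sqrt (real N * real M)"
  have \<epsilon>: "0 < \<epsilon>" using assms by (simp add: \<epsilon>_def)
  have bound: "g t * (fejer N t * fejer M t) \<le> \<epsilon> * real N / 2 * fejer M t + 1 / (2 * \<epsilon> * real M) * fejer N t"
    if t: "t \<in> {0..1}" for t
  proof -
    let ?s = "sin (pi * t)"
    \<comment> \<open>AM-GM; this \<open>\<epsilon>\<close> balances the two resulting integrals\<close>
    have "?s * (2 * \<epsilon>) \<le> \<epsilon>\<^sup>2 + ?s\<^sup>2"
      using zero_le_power2[of "\<epsilon> - ?s"] by (simp add: power2_eq_square algebra_simps)
    then have "?s \<le> (\<epsilon>\<^sup>2 + ?s\<^sup>2) / (2 * \<epsilon>)" using \<epsilon> by (simp add: field_simps)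
    also have "\<dots> = \<epsilon> / 2 + ?s\<^sup>2 / (2 * \<epsilon>)"
      using \<epsilon> by (simp add: field_simps power2_eq_square)
    finally have "g t \<le> \<epsilon> / 2 + ?s\<^sup>2 / (2 * \<epsilon>)"
      using g[of t] min_le_sin_pi[of t] t by auto
    then have "g t * (fejer N t * fejer M t) \<le> (\<epsilon> / 2 + ?s\<^sup>2 / (2 * \<epsilon>)) * (fejer N t * fejer M t)"
      by (intro mult_right_mono) (auto simp: fejer_nonneg)
    also have "\<dots> = \<epsilon> / 2 * fejer M t * fejer N t + fejer N t / (2 * \<epsilon>) * (fejer M t * ?s\<^sup>2)"
      by (simp add: algebra_simps)
    also have "\<dots> \<le> \<epsilon> / 2 * fejer M t * real N + fejer N t / (2 * \<epsilon>) * (1 / real M)"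
      using \<epsilon> by (intro add_mono mult_left_mono fejer_le fejer_sin_le) (auto simp: fejer_nonneg)
    finally show ?thesis by (simp add: algebra_simps)
  qed
  have rhs: "((\<lambda>t. \<epsilon> * real N / 2 * fejer M t + 1 / (2 * \<epsilon> * real M) * fejer N t) has_integral
      \<epsilon> * real N / 2 * 1 + 1 / (2 * \<epsilon> * real M) * 1) {0..1}"
    by (intro has_integral_add has_integral_mult_right fejer_has_integral assms)
  have "integral {0..1} (\<lambda>t. g t * (fejer N t * fejer M t)) \<le> \<epsilon> * real N / 2 * 1 + 1 / (2 * \<epsilon> * real M) * 1"
    unfolding integral_unique[OF rhs, symmetric]
    using rhs bound
    by (intro integral_le integrable_continuous_real continuous_intros cont) auto
  also have "\<dots> = sqrt (real N / real M)"
  proof -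
    \<comment> \<open>Naming the square roots of N and M makes the identity one between rational
      functions.\<close>
    obtain n m where "real N = n\<^sup>2" "real M = m\<^sup>2" "0 < n" "0 < m"
      using assms by (metis of_nat_0_less_iff real_sqrt_gt_zero real_sqrt_pow2 less_imp_le)
    then show ?thesis
      by (simp add: \<epsilon>_def real_sqrt_mult real_sqrt_divide power2_eq_square field_simps)
  qed
  finally show ?thesis .
qed

text \<open>Enlarging the square by one adds a row, a column and a corner. Row and column are at
  most a geometric sum below 1, the corner is at most 1; hence the 3.\<close>

lemma sum_half_powers_le:
  fixes c :: "nat \<Rightarrow> nat \<Rightarrow> real"
  assumes sym: "\<And>i j. c i j = c j i" and le: "\<And>i j. i \<le> j \<Longrightarrow> c i j \<le> (1/2) ^ (j - i)"
  shows "(\<Sum>i<m. \<Sum>j<m. c i j) \<le> 3 * real m"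
proof (induction m)
  case (Suc m)
  have geo: "(\<Sum>i<n. (1/2::real) ^ (n - i)) = 1 - (1/2) ^ n" for n
  proof (induction n)
    case (Suc n)
    have "(\<Sum>i<Suc n. (1/2::real) ^ (Suc n - i)) = (\<Sum>i<n. (1/2) * (1/2) ^ (n - i)) + 1/2"
      by (simp add: Suc_diff_le)
    then show ?case using Suc by (simp flip: sum_divide_distrib add: diff_divide_distrib)
  qed simp
  have "(\<Sum>i<m. c i m) \<le> (\<Sum>i<m. (1/2) ^ (m - i))"
    by (intro sum_mono le) auto
  also have "\<dots> \<le> 1" by (simp add: geo)
  finally have "(\<Sum>i<m. c i m) \<le> 1" .
  moreover have "(\<Sum>i<m. c m i) = (\<Sum>i<m. c i m)"
    by (intro sum.cong sym refl)
  moreover have "c m m \<le> 1" using le[of m m] by simp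
  ultimately show ?case using Suc by (simp add: sum.distrib)
qed simp

text \<open>The scales 4^i make sqrt(4^i / 4^j) = 2^(i - j), so the matrix of inner products decays
  geometrically off the diagonal. Its m^2 entries then sum to at most 3m, to be divided by
  m^2.\<close>

lemma integral_fejer_average_le:
  assumes cont: "continuous_on {0..1} g"
    and g: "\<And>t. 0 \<le> t \<Longrightarrow> t \<le> 1 \<Longrightarrow> g t \<le> min t (1 - t)"
  shows "integral {0..1} (\<lambda>t. g t * ((\<Sum>i<m. fejer (4 ^ i) t) / real m)\<^sup>2) \<le> 3 / real m"
proof -
  define c where "c i j = integral {0..1} (\<lambda>t. g t * (fejer (4 ^ i) t * fejer (4 ^ j) t))" for i j
  have int: "(\<lambda>t. g t * (fejer (4 ^ i) t * fejer (4 ^ j) t)) integrable_on {0..1}" for i j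
    by (intro integrable_continuous_real continuous_intros cont)
  have "integral {0..1} (\<lambda>t. g t * ((\<Sum>i<m. fejer (4 ^ i) t) / real m)\<^sup>2)
      = integral {0..1} (\<lambda>t. (\<Sum>i<m. \<Sum>j<m. g t * (fejer (4 ^ i) t * fejer (4 ^ j) t)) / (real m)\<^sup>2)"
    by (simp add: power_divide power2_eq_square sum_product flip: sum_distrib_left)
  also have "\<dots> = (\<Sum>i<m. \<Sum>j<m. c i j) / (real m)\<^sup>2"
    by (simp add: integral_sum int integrable_sum c_def)
  also have "\<dots> \<le> 3 * real m / (real m)\<^sup>2"
  proof (intro divide_right_mono sum_half_powers_le)
    show "c i j = c j i" for i j by (simp add: c_def mult_ac)
    show "c i j \<le> (1/2) ^ (j - i)" if "i \<le> j" for i j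
    proof -
      have four: "(4::real) ^ k = (2 ^ k)\<^sup>2" for k
        by (simp add: power2_eq_square flip: power_mult_distrib)
      have "c i j \<le> sqrt (real (4 ^ i) / real (4 ^ j))"
        unfolding c_def by (intro integral_fejer_fejer_le cont g) auto
      also have "real (4 ^ i) / real (4 ^ j) = ((1/2) ^ (j - i))\<^sup>2"
        using that four by (simp add: power_diff power_one_over field_simps)
      finally show ?thesis by simp
    qed
  qed simp
  also have "\<dots> = 3 / real m"
    by (simp add: power2_eq_square)
  finally show ?thesis .
qed

subsection \<open>Fourier coefficients of arcs\<close>

text \<open>For 0 \<le> b \<le> 1/2 and t in [0,1] this is the measure of the part of an arc of
  length b that a rotation by t moves out of the arc: b minus the autocorrelation of its indicator.
  Hence its cosine coefficients involve squared Fourier coefficients of the arc.\<close>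

definition trapezoid :: "real \<Rightarrow> real \<Rightarrow> real" where
  "trapezoid b t = min (min t (1 - t)) b"

lemma trapezoid_cos_has_integral_0:
  assumes "0 \<le> b" "b \<le> 1/2"
  shows "(trapezoid b has_integral b - b\<^sup>2) {0..1}"
proof -
  have "((\<lambda>t. t) has_integral b\<^sup>2 / 2 - 0\<^sup>2 / 2) {0..b}"
    using assms
    by (intro fundamental_theorem_of_calculus)
       (auto intro!: derivative_eq_intros simp flip: has_real_derivative_iff_has_vector_derivative)
  then have 1: "(trapezoid b has_integral b\<^sup>2 / 2) {0..b}"
    by (rule has_integral_eq_rhs[OF has_integral_eq[rotated]]) (use assms in \<open>auto simp: trapezoid_def\<close>)
  have "((\<lambda>t. b) has_integral b * (1 - b) - b * b) {b..1-b}"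
    using assms
    by (intro fundamental_theorem_of_calculus)
       (auto intro!: derivative_eq_intros simp flip: has_real_derivative_iff_has_vector_derivative)
  then have 2: "(trapezoid b has_integral b * (1 - b) - b * b) {b..1-b}"
    by (rule has_integral_eq_rhs[OF has_integral_eq[rotated]]) (use assms in \<open>auto simp: trapezoid_def\<close>)
  have "((\<lambda>t. 1 - t) has_integral (1 - 1\<^sup>2 / 2) - ((1 - b) - (1 - b)\<^sup>2 / 2)) {1-b..1}"
    using assms
    by (intro fundamental_theorem_of_calculus)
       (auto intro!: derivative_eq_intros simp flip: has_real_derivative_iff_has_vector_derivative)
  then have 3: "(trapezoid b has_integral (1 - 1\<^sup>2 / 2) - ((1 - b) - (1 - b)\<^sup>2 / 2)) {1-b..1}"
    by (rule has_integral_eq_rhs[OF has_integral_eq[rotated]]) (use assms in \<open>auto simp: trapezoid_def\<close>)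
  have "(trapezoid b has_integral b\<^sup>2 / 2 + (b * (1 - b) - b * b)
      + ((1 - 1\<^sup>2 / 2) - ((1 - b) - (1 - b)\<^sup>2 / 2))) {0..1}"
    using assms by (intro has_integral_combine[OF _ _ has_integral_combine[OF _ _ 1 2] 3]) auto
  then show ?thesis
    by (rule has_integral_eq_rhs) (simp add: power2_eq_square field_simps)
qed

text \<open>Each linear piece has an explicit antiderivative. As w is a multiple of 2 pi, the values
  at 1 - b mirror those at b, and the terms b sin(wb)/w cancel in the total.\<close>

lemma trapezoid_cos_has_integral:
  fixes k :: int
  assumes b: "0 \<le> b" "b \<le> 1/2" and k: "k \<noteq> 0"
  shows "((\<lambda>t. trapezoid b t * cos (2 * pi * of_int k * t)) has_integral
    - ((1 - cos (2 * pi * of_int k * b)) / (2 * pi\<^sup>2 * (of_int k)\<^sup>2))) {0..1}"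
proof -
  define w where "w = 2 * pi * real_of_int k"
  have w: "w \<noteq> 0" using k by (simp add: w_def)
  let ?f = "\<lambda>t. trapezoid b t * cos (w * t)"
  have sw: "sin w = 0" and cw: "cos w = 1"
    using sin_int_2pin[of k] cos_int_2pin[of k] by (simp_all add: w_def)
  have s: "sin (w * (1 - b)) = - sin (w * b)" and c: "cos (w * (1 - b)) = cos (w * b)"
    using sw cw by (simp_all add: right_diff_distrib sin_diff cos_diff)
  have "((\<lambda>t. t * cos (w * t)) has_integral
      (b * sin (w * b) / w + cos (w * b) / w\<^sup>2) - (0 * sin (w * 0) / w + cos (w * 0) / w\<^sup>2)) {0..b}"
    using b w
    by (intro fundamental_theorem_of_calculus)
       (auto intro!: derivative_eq_intros simp: power2_eq_square field_simps
         simp flip: has_real_derivative_iff_has_vector_derivative)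
  then have 1: "(?f has_integral (b * sin (w * b) / w + (cos (w * b) - 1) / w\<^sup>2)) {0..b}"
    by (rule has_integral_eq_rhs[OF has_integral_eq[rotated]]) (use b in \<open>auto simp: trapezoid_def diff_divide_distrib\<close>)
  have "((\<lambda>t. b * cos (w * t)) has_integral b * sin (w * (1 - b)) / w - b * sin (w * b) / w) {b..1-b}"
    using b w
    by (intro fundamental_theorem_of_calculus)
       (auto intro!: derivative_eq_intros simp: power2_eq_square field_simps
         simp flip: has_real_derivative_iff_has_vector_derivative)
  then have 2: "(?f has_integral - (2 * b * sin (w * b) / w)) {b..1-b}"
    by (rule has_integral_eq_rhs[OF has_integral_eq[rotated]]) (use b in \<open>auto simp: trapezoid_def s\<close>)
  have "((\<lambda>t. (1 - t) * cos (w * t)) has_integral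
      ((1 - 1) * sin (w * 1) / w - cos (w * 1) / w\<^sup>2)
      - ((1 - (1 - b)) * sin (w * (1 - b)) / w - cos (w * (1 - b)) / w\<^sup>2)) {1-b..1}"
    using b w
    by (intro fundamental_theorem_of_calculus)
       (auto intro!: derivative_eq_intros simp: power2_eq_square field_simps
         simp flip: has_real_derivative_iff_has_vector_derivative)
  then have 3: "(?f has_integral (b * sin (w * b) / w + (cos (w * b) - 1) / w\<^sup>2)) {1-b..1}"
    unfolding s c
    by (rule has_integral_eq_rhs[OF has_integral_eq[rotated]]) (use b in \<open>auto simp: trapezoid_def diff_divide_distrib cw\<close>)
  have "(?f has_integral (b * sin (w * b) / w + (cos (w * b) - 1) / w\<^sup>2) + - (2 * b * sin (w * b) / w)
      + (b * sin (w * b) / w + (cos (w * b) - 1) / w\<^sup>2)) {0..1}"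
    using b by (intro has_integral_combine[OF _ _ has_integral_combine[OF _ _ 1 2] 3]) auto
  also have "(b * sin (w * b) / w + (cos (w * b) - 1) / w\<^sup>2) + - (2 * b * sin (w * b) / w)
      + (b * sin (w * b) / w + (cos (w * b) - 1) / w\<^sup>2) = - (2 * (1 - cos (w * b)) / w\<^sup>2)"
    using w by (simp add: field_simps)
  also have "\<dots> = - ((1 - cos (w * b)) / (2 * pi\<^sup>2 * (of_int k)\<^sup>2))"
    using k by (simp add: w_def power_mult_distrib field_simps)
  finally show ?thesis by (simp add: w_def)
qed

text \<open>
  Otherwise four increasing points of \<open>[0,1]\<close> would lie alternately inside and outside \<open>I\<close>, which the
  translates by integers of an interval do not allow.
\<close>
lemma circle_interval_cases:
  assumes "circle_interval I"
  shows "is_interval I \<or> is_interval ({0..1} - I)"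
proof (rule ccontr)
  obtain J where J: "is_interval J" and I: "I = {x \<in> {0..1}. \<exists>n::int. x + of_int n \<in> J}"
    using assms by (auto simp: circle_interval_def)
  have btw: "z \<in> J" if "x \<in> J" "y \<in> J" "x \<le> z" "z \<le> y" for x y z
    using that J unfolding is_interval_1 by blast
  have inI: "x \<in> I" if "x + of_int n \<in> J" "0 \<le> x" "x \<le> 1" for x and n :: int
    using that I by auto
  \<comment> \<open>Two points of I lie in translates of J by n and m. If n \<le> m, convexity of J
    captures x3 + n; otherwise, all points being within distance 1, it captures x1 + n.\<close>
  have outin: False
    if x: "0 \<le> x1" "x1 \<le> x2" "x2 \<le> x3" "x3 \<le> x4" "x4 \<le> 1" "x1 \<notin> I" "x2 \<in> I" "x3 \<notin> I" "x4 \<in> I"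
    for x1 x2 x3 x4
  proof -
    obtain n m :: int where nm: "x2 + of_int n \<in> J" "x4 + of_int m \<in> J"
      using x(7,9) unfolding I by blast
    consider "n \<le> m" | "m + 1 \<le> n" by linarith
    then show False
    proof cases
      case 1
      then have "real_of_int n \<le> of_int m" by simp
      then have "x3 + of_int n \<in> J" using x(1-5) by (intro btw[OF nm]) linarith+
      then show False using inI[of x3 n] x by linarith
    next
      case 2
      then have "real_of_int m + 1 \<le> of_int n" by linarith
      then have "x1 + of_int n \<in> J" using x(1-5) by (intro btw[OF nm(2,1)]) linarith+
      then show False using inI[of x1 n] x by linarith
    qed
  qed
  \<comment> \<open>Equal translates capture x2; if they differ, x4 moved by the smaller of n and m
    falls between the two known points of J.\<close>
  have inout: False
    if x: "0 \<le> x1" "x1 \<le> x2" "x2 \<le> x3" "x3 \<le> x4" "x4 \<le> 1" "x1 \<in> I" "x2 \<notin> I" "x3 \<in> I" "x4 \<notin> I"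
    for x1 x2 x3 x4
  proof -
    obtain n m :: int where nm: "x1 + of_int n \<in> J" "x3 + of_int m \<in> J"
      using x(6,8) unfolding I by blast
    consider "n = m" | "n + 1 \<le> m" | "m + 1 \<le> n" by linarith
    then show False
    proof cases
      case 1
      then have "x2 + of_int n \<in> J" using x(1-5) by (intro btw[OF nm]) linarith+
      then show False using inI[of x2 n] x by linarith
    next
      case 2
      then have "real_of_int n + 1 \<le> of_int m" by linarith
      then have "x4 + of_int n \<in> J" using x(1-5) by (intro btw[OF nm]) linarith+
      then show False using inI[of x4 n] x by linarith
    next
      case 3
      then have "real_of_int m + 1 \<le> of_int n" by linarith
      then have "x4 + of_int m \<in> J" using x(1-5) by (intro btw[OF nm(2,1)]) linarith+
      then show False using inI[of x4 m] x by linarith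
    qed
  qed
  assume "\<not> (is_interval I \<or> is_interval ({0..1} - I))"
  then have "\<not> is_interval I" "\<not> is_interval ({0..1} - I)" by simp_all
  then obtain a b c a' b' c' where abc: "a \<in> I" "b \<notin> I" "c \<in> I" "a \<le> b" "b \<le> c"
    and abc': "a' \<in> {0..1} - I" "b' \<notin> {0..1} - I" "c' \<in> {0..1} - I" "a' \<le> b'" "b' \<le> c'"
    unfolding is_interval_1[of I] is_interval_1[of "{0..1} - I"] by blast
  have "a \<in> {0..1}" "c \<in> {0..1}" using abc I by simp_all
  moreover have "b' \<in> {0..1}" using abc' by simp
  ultimately have r: "a \<in> {0..1}" "c \<in> {0..1}" "b' \<in> I" using abc' by simp_all
  \<comment> \<open>The position of a' relative to a and c decides which four of the points
    alternate.\<close>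
  consider "a' \<le> a" | "a \<le> a'" "a' \<le> c" | "a \<le> a'" "c \<le> a'" by linarith
  then show False
  proof cases
    case 1
    then show False using outin[of a' a b c] abc abc' r by auto
  next
    case 2
    then show False using inout[of a a' b' c'] abc abc' r by auto
  next
    case 3
    then show False using inout[of a b c a'] abc abc' r by auto
  qed
qed

text \<open>The infimum and supremum serve as c and d, and c = d = 0 for the empty set. Bounding the
  two differences by finite sets makes S and [c,d] interchangeable under integrals.\<close>

lemma interval_between_endpoints:
  fixes S :: "real set"
  assumes "is_interval S" "S \<subseteq> {0..1}"
  obtains c d where "0 \<le> c" "c \<le> d" "d \<le> 1" "S - {c..d} \<subseteq> {c, d}" "{c..d} - S \<subseteq> {c, d}"
proof (cases "S = {}")
  case True
  then show ?thesis using that[of 0 0] by auto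
next
  case False
  have bdd: "bdd_below S" "bdd_above S"
    using assms by (meson bdd_below_Icc bdd_below_mono bdd_above_Icc bdd_above_mono)+
  have sub: "S \<subseteq> {Inf S..Sup S}"
    using bdd by (auto intro: cInf_lower cSup_upper)
  have sup: "x \<in> S" if x: "Inf S < x" "x < Sup S" for x
  proof -
    obtain y where "y \<in> S" "y < x" using cInf_lessD[OF False x(1)] by blast
    moreover obtain z where "z \<in> S" "x < z" using less_cSupD[OF False x(2)] by blast
    ultimately show ?thesis using assms(1) unfolding is_interval_1 by (meson less_imp_le)
  qed
  have "0 \<le> Inf S" using assms False by (intro cInf_greatest) auto
  moreover have "Sup S \<le> 1" using assms False by (intro cSup_least) auto
  moreover have "Inf S \<le> Sup S" using sub False by force
  moreover have "{Inf S..Sup S} - S \<subseteq> {Inf S, Sup S}" using sup by force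
  ultimately show ?thesis using sub that[of "Inf S" "Sup S"] by auto
qed

section \<open>Fourier integrals over intervals and arcs\<close>

definition wave :: "int \<Rightarrow> real \<Rightarrow> complex" where
  "wave k x = cis (- (2 * pi * of_int k * x))"

lemma wave_has_integral:
  assumes "k \<noteq> 0" "c \<le> d"
  shows "(wave k has_integral (wave k d - wave k c) / (- (2 * pi * of_int k) * \<i>)) {c..d}"
proof -
  define w where "w = 2 * pi * real_of_int k"
  have w: "w \<noteq> 0" using assms by (simp add: w_def)
  have wave: "wave k = (\<lambda>x. cis (- (w * x)))" by (simp add: wave_def w_def fun_eq_iff)
  \<comment> \<open>The antiderivative is differentiated in a complex variable and then restricted
    to the real line.\<close>
  have D: "((\<lambda>z. exp (- (\<i> * (of_real w * z))) / (- w * \<i>)) has_field_derivative exp (- (\<i> * (of_real w * of_real x))))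
      (at (of_real x))" for x :: real
    using w by (auto intro!: derivative_eq_intros)
  have "((\<lambda>x. exp (- (\<i> * (of_real w * of_real x))) / (- w * \<i>)) has_vector_derivative exp (- (\<i> * (of_real w * of_real x))))
      (at x within {c..d})" for x :: real
    by (rule has_vector_derivative_real_field[OF D])
  then have "((\<lambda>x. cis (- (w * x)) / (- w * \<i>)) has_vector_derivative cis (- (w * x))) (at x within {c..d})" for x
    by (simp add: cis_conv_exp)
  then have "(wave k has_integral (cis (- (w * d)) / (- w * \<i>) - cis (- (w * c)) / (- w * \<i>))) {c..d}"
    unfolding wave by (intro fundamental_theorem_of_calculus assms) auto
  then show ?thesis by (simp add: wave w_def diff_divide_distrib)
qed

text \<open>This is the squared chord of the unit circle for the angle 2 pi k (d - c), so it depends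
  on the interval through its length alone.\<close>

lemma norm_wave_diff:
  "(cmod (wave k d - wave k c))\<^sup>2 = 2 - 2 * cos (2 * pi * of_int k * (d - c))"
proof -
  define w where "w = 2 * pi * real_of_int k"
  have "(cmod (wave k d - wave k c))\<^sup>2
      = (cos (w * d) - cos (w * c))\<^sup>2 + (sin (w * c) - sin (w * d))\<^sup>2"
    unfolding cmod_power2 by (simp add: wave_def w_def)
  also have "\<dots> = ((cos (w * d))\<^sup>2 + (sin (w * d))\<^sup>2) + ((cos (w * c))\<^sup>2 + (sin (w * c))\<^sup>2)
      - 2 * (cos (w * d) * cos (w * c) + sin (w * d) * sin (w * c))"
    by (simp add: power2_eq_square algebra_simps)
  also have "\<dots> = 2 - 2 * cos (w * (d - c))"
    by (simp add: right_diff_distrib cos_diff)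
  finally show ?thesis by (simp add: w_def)
qed

text \<open>A bridge from the Lebesgue integral in the definition to \<open>has_integral\<close>,
  where endpoints can be ignored and complements taken.\<close>

lemma fourier_coeff_eq_wave:
  assumes I: "I \<in> sets borel" "I \<subseteq> {0..1}"
  shows "fourier_coeff (indicator I) k = (LINT x:I|lborel. wave k x)"
    and "(wave k has_integral fourier_coeff (indicator I) k) I"
proof -
  have exp: "exp (- 2 * of_real pi * \<i> * of_int k * of_real x) = wave k x" for x
    by (simp add: wave_def cis_conv_exp mult_ac)
  have cont: "continuous_on {0..1} (wave k)"
    unfolding wave_def by (intro continuous_intros)
  have int: "set_integrable lborel I (wave k)"
    by (rule set_integrable_subset[OF borel_integrable_atLeastAtMost'[OF cont]]) (use I in auto)
  show eq: "fourier_coeff (indicator I) k = (LINT x:I|lborel. wave k x)"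
    unfolding fourier_coeff_def exp set_lebesgue_integral_def
    using I(2) by (intro Bochner_Integration.integral_cong) (auto simp: indicator_def)
  show "(wave k has_integral fourier_coeff (indicator I) k) I"
    unfolding eq set_borel_integral_eq_integral(2)[OF int]
    by (rule integrable_integral[OF set_borel_integral_eq_integral(1)[OF int]])
qed

lemma fourier_coeff_indicator_0:
  assumes "I \<in> sets borel" "I \<subseteq> {0..1}"
  shows "fourier_coeff (indicator I) 0 = of_real (measure lborel I)"
proof -
  have "emeasure lborel I \<le> emeasure lborel {0..1::real}"
    using assms by (intro emeasure_mono) auto
  then have "emeasure lborel I \<noteq> \<infinity>" by (auto simp: top_unique)
  then show ?thesis
    using assms fourier_coeff_eq_wave(1)[OF assms, of 0] set_integral_const[of I lborel "1::complex"]
    by (simp add: wave_def scaleR_conv_of_real)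
qed

text \<open>S differs from a closed interval of length l by at most two points. It is kept general
  so as to serve for an arc and for its complement.\<close>

lemma wave_has_integral_interval:
  assumes "is_interval S" "S \<subseteq> {0..1}"
  obtains l J where "0 \<le> l" "l \<le> 1" "\<And>k. (wave k has_integral J k) S" "J 0 = of_real l"
    "\<And>k. k \<noteq> 0 \<Longrightarrow> (cmod (J k))\<^sup>2 = (1 - cos (2 * pi * of_int k * l)) / (2 * pi\<^sup>2 * (of_int k)\<^sup>2)"
proof -
  obtain c d where cd: "0 \<le> c" "c \<le> d" "d \<le> 1" "S - {c..d} \<subseteq> {c, d}" "{c..d} - S \<subseteq> {c, d}"
    by (rule interval_between_endpoints[OF assms]) (rule that)
  define J where "J k = (if k = 0 then of_real (d - c) else
      (wave k d - wave k c) / (- (2 * pi * of_int k) * \<i>))" for k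
  have "(wave k has_integral J k) {c..d}" for k
  proof (cases "k = 0")
    case True
    have "((\<lambda>x. 1::complex) has_integral of_real (d - c)) {c..d}"
      using has_integral_const_real[of "1::complex" c d] cd by (simp add: scaleR_conv_of_real)
    then show ?thesis using True by (simp add: J_def wave_def[abs_def])
  qed (use cd wave_has_integral in \<open>simp add: J_def\<close>)
  moreover have "(wave k has_integral J k) {c..d} \<longleftrightarrow> (wave k has_integral J k) S" for k
    by (rule has_integral_spike_set_eq; rule negligible_subset[of "{c, d}"]) (use cd in auto)
  moreover have "(cmod (J k))\<^sup>2 = (1 - cos (2 * pi * of_int k * (d - c))) / (2 * pi\<^sup>2 * (of_int k)\<^sup>2)"
    if "k \<noteq> 0" for k
    using that norm_wave_diff[of k d c]
    by (simp add: J_def norm_divide norm_mult power_divide power_mult_distrib field_simps)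
  ultimately show ?thesis
    using cd by (intro that[of "d - c" J]) (simp_all add: J_def)
qed

lemma circle_interval_borel:
  assumes "circle_interval I"
  shows "I \<in> sets borel" "I \<subseteq> {0..1}"
proof -
  show I: "I \<subseteq> {0..1}" using assms by (auto simp: circle_interval_def)
  show "I \<in> sets borel"
    using circle_interval_cases[OF assms]
  proof
    assume "is_interval ({0..1} - I)"
    then have "{0..1} - ({0..1} - I) \<in> sets borel"
      by (intro sets.Diff real_interval_borel_measurable) auto
    also have "{0..1} - ({0..1} - I) = I" using I by blast
    finally show ?thesis .
  qed (rule real_interval_borel_measurable)
qed

text \<open>One of I and its complement is an interval, of length l say; their coefficients at k
  \<noteq> 0 are opposite, so the moduli agree. Both l - l^2 and cos(2 pi k l) are unchanged by l ->
  1 - l, which allows b to be the smaller of the two lengths.\<close>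

lemma fourier_coeff_circle_interval:
  assumes "circle_interval I"
  defines "a \<equiv> measure lborel I"
  obtains b where "0 \<le> b" "b \<le> 1/2" "a - a\<^sup>2 = b - b\<^sup>2"
    "\<And>k. k \<noteq> 0 \<Longrightarrow> (cmod (fourier_coeff (indicator I) k))\<^sup>2
      = (1 - cos (2 * pi * of_int k * b)) / (2 * pi\<^sup>2 * (of_int k)\<^sup>2)"
proof -
  let ?K = "fourier_coeff (indicator I)"
  note bor = circle_interval_borel[OF assms(1)]
  note K = fourier_coeff_eq_wave(2)[OF bor]
  have K0: "?K 0 = of_real a" using fourier_coeff_indicator_0[OF bor] by (simp add: a_def)
  have cos_refl: "cos (2 * pi * of_int k * (1 - l)) = cos (2 * pi * of_int k * l)" for k :: int and l
    using cos_int_2pin[of k] sin_int_2pin[of k] by (simp add: right_diff_distrib cos_diff)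
  have "\<exists>l. 0 \<le> l \<and> l \<le> 1 \<and> (a = l \<or> a = 1 - l) \<and> (\<forall>k. k \<noteq> 0 \<longrightarrow>
      (cmod (?K k))\<^sup>2 = (1 - cos (2 * pi * of_int k * l)) / (2 * pi\<^sup>2 * (of_int k)\<^sup>2))"
    using circle_interval_cases[OF assms(1)]
  proof
    assume "is_interval I"
    note int = this
    obtain l J where l: "0 \<le> l" "l \<le> 1" and J: "\<And>k. (wave k has_integral J k) I" "J 0 = of_real l"
      "\<And>k. k \<noteq> 0 \<Longrightarrow> (cmod (J k))\<^sup>2 = (1 - cos (2 * pi * of_int k * l)) / (2 * pi\<^sup>2 * (of_int k)\<^sup>2)"
      by (rule wave_has_integral_interval[OF int bor(2)]) (rule that)
    have *: "J k = ?K k" for k by (rule has_integral_unique[OF J(1) K])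
    have "a = l" using *[of 0] K0 J(2) by simp
    then show ?thesis using l J(3) unfolding * by (intro exI[of _ l]) simp
  next
    assume "is_interval ({0..1} - I)"
    note int = this
    obtain l J where l: "0 \<le> l" "l \<le> 1" and J: "\<And>k. (wave k has_integral J k) ({0..1} - I)" "J 0 = of_real l"
      "\<And>k. k \<noteq> 0 \<Longrightarrow> (cmod (J k))\<^sup>2 = (1 - cos (2 * pi * of_int k * l)) / (2 * pi\<^sup>2 * (of_int k)\<^sup>2)"
      by (rule wave_has_integral_interval[OF int Diff_subset]) (rule that)
    have whole: "(wave k has_integral of_bool (k = 0)) {0..1}" for k
    proof (cases "k = 0")
      case True
      then show ?thesis
        using has_integral_const_real[of "1::complex" 0 1] by (simp add: wave_def[abs_def])
    next
      case False
      have "wave k 1 = 1" using cos_int_2pin[of k] sin_int_2pin[of k]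
        by (simp add: wave_def complex_eq_iff)
      then show ?thesis using wave_has_integral[OF False, of 0 1] False by (simp add: wave_def)
    qed
    have "J k = of_bool (k = 0) - ?K k" for k
      using has_integral_unique[OF J(1) has_integral_setdiff[OF whole K]] bor by simp
    then have *: "?K k = of_bool (k = 0) - J k" for k by simp
    have "of_real a = complex_of_real (1 - l)" using *[of 0] K0 J(2) by simp
    then have "a = 1 - l" by (simp only: of_real_eq_iff)
    moreover have "cmod (?K k) = cmod (J k)" if "k \<noteq> 0" for k
      using that by (simp add: *)
    ultimately show ?thesis using l J(3) by (intro exI[of _ l]) simp
  qed
  then obtain l where l: "0 \<le> l" "l \<le> 1" "a = l \<or> a = 1 - l" and
    Kl: "\<And>k. k \<noteq> 0 \<Longrightarrow>
      (cmod (?K k))\<^sup>2 = (1 - cos (2 * pi * of_int k * l)) / (2 * pi\<^sup>2 * (of_int k)\<^sup>2)"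
    by (elim exE conjE) (rule that, simp_all)
  have sq: "a - a\<^sup>2 = l - l\<^sup>2"
    using l(3) by (elim disjE, simp_all only:) (simp add: power2_eq_square algebra_simps)
  also have "l - l\<^sup>2 = (1 - l) - (1 - l)\<^sup>2"
    by (simp add: power2_eq_square algebra_simps)
  finally have sq': "a - a\<^sup>2 = (1 - l) - (1 - l)\<^sup>2" .
  show ?thesis
  proof (cases "l \<le> 1/2")
    case True
    show ?thesis by (rule that[OF l(1) True sq Kl])
  next
    case False
    with l have "0 \<le> 1 - l" "1 - l \<le> 1/2" by simp_all
    then show ?thesis by (rule that[OF _ _ sq']) (simp add: cos_refl Kl)
  qed
qed

text \<open>At k = 0 this is a - a^2 = b - b^2; at other k it compares the explicit formulas for the
  trapezoid and for the arc. A single b works for all k.\<close>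

lemma covariance_eq_integral:
  assumes "circle_interval I"
  defines "a \<equiv> measure lborel I"
  obtains b where "\<And>k::int. ((\<lambda>t. trapezoid b t * cos (2 * pi * of_int k * t)) has_integral
    a * of_bool (k = 0) - (cmod (fourier_coeff (indicator I) k))\<^sup>2) {0..1}"
proof -
  let ?K = "fourier_coeff (indicator I)"
  obtain b where b: "0 \<le> b" "b \<le> 1/2" "a - a\<^sup>2 = b - b\<^sup>2"
    and K: "\<And>k. k \<noteq> 0 \<Longrightarrow> (cmod (?K k))\<^sup>2 = (1 - cos (2 * pi * of_int k * b)) / (2 * pi\<^sup>2 * (of_int k)\<^sup>2)"
    by (rule fourier_coeff_circle_interval[OF assms(1), folded a_def]) (rule that)
  have K0: "(cmod (?K 0))\<^sup>2 = a\<^sup>2"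
    using fourier_coeff_indicator_0[OF circle_interval_borel[OF assms(1)]] by (simp add: a_def)
  have "((\<lambda>t. trapezoid b t * cos (2 * pi * of_int k * t)) has_integral
    a * of_bool (k = 0) - (cmod (?K k))\<^sup>2) {0..1}" for k
  proof (cases "k = 0")
    case True
    then show ?thesis using trapezoid_cos_has_integral_0[OF b(1,2)] b(3) K0 by simp
  next
    case False
    then show ?thesis using trapezoid_cos_has_integral[OF b(1,2) False] K[OF False] by simp
  qed
  then show ?thesis by (rule that)
qed

lemma fourier_coeff_uminus: "fourier_coeff f (- k) = cnj (fourier_coeff f k)"
  unfolding fourier_coeff_def set_lebesgue_integral_def Bochner_Integration.integral_cnj[symmetric]
  by (intro Bochner_Integration.integral_cong) (simp_all add: exp_cnj mult_ac)

subsection \<open>Linear statistics of the point process\<close>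

lemma det_mat_2:
  fixes A :: "complex mat"
  assumes "A \<in> carrier_mat 2 2"
  shows "Determinant.det A = A $$ (0,0) * A $$ (1,1) - A $$ (1,0) * A $$ (0,1)"
proof -
  have "mat_delete A i 0 \<in> carrier_mat 1 1" for i
    using mat_delete_carrier[of A 2 2] assms by simp
  then have "Determinant.det (mat_delete A i 0) = mat_delete A i 0 $$ (0,0)" for i
    by (rule det_single)
  then show ?thesis
    using assms laplace_expansion_column[OF assms, of 0]
    by (simp add: numeral_2_eq_2 cofactor_def mat_delete_def lessThan_Suc)
qed

locale circle_interval_process = prob_space M
  for M :: "'a measure" and \<omega> :: "'a \<Rightarrow> int \<Rightarrow> bool" and I :: "real set" +
  assumes circle_interval: "circle_interval I"
    and measurable_config [measurable]: "\<omega> \<in> M \<rightarrow>\<^sub>M config_space UNIV"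
    and law: "determinantal_law (indicator I) (distr M (config_space UNIV) \<omega>)"
begin

abbreviation density :: real where "density \<equiv> measure lborel I"

lemma measurable_occupation [measurable]: "(\<lambda>x. \<omega> x k) \<in> M \<rightarrow>\<^sub>M count_space UNIV"
  using measurable_component_singleton[of k UNIV "\<lambda>_. count_space UNIV"]
  by (intro measurable_compose[OF measurable_config]) (simp add: config_space_def)

text \<open>Pulls the determinant formula back from the law to the space \<open>M\<close> on which
  the process lives.\<close>

lemma inclusion_prob:
  assumes "distinct ks"
  shows "complex_of_real (prob {x \<in> space M. \<forall>k\<in>set ks. \<omega> x k}) =
    Determinant.det (mat (length ks) (length ks) (\<lambda>(i, j). fourier_coeff (indicator I) (ks ! i - ks ! j)))"
proof -
  let ?P = "distr M (config_space UNIV) \<omega>"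
  have "{\<eta> \<in> space (config_space UNIV). \<forall>k\<in>set ks. \<eta> k} \<in> sets (config_space UNIV)"
    unfolding config_space_def by measurable
  then have "measure ?P {\<eta> \<in> space ?P. \<forall>k\<in>set ks. \<eta> k}
      = prob (\<omega> -` {\<eta> \<in> space (config_space UNIV). \<forall>k\<in>set ks. \<eta> k} \<inter> space M)"
    by (simp add: measure_distr)
  also have "\<omega> -` {\<eta> \<in> space (config_space UNIV). \<forall>k\<in>set ks. \<eta> k} \<inter> space M = {x \<in> space M. \<forall>k\<in>set ks. \<omega> x k}"
    using measurable_space[OF measurable_config] by auto
  finally have eq: "measure ?P {\<eta> \<in> space ?P. \<forall>k\<in>set ks. \<eta> k} = prob {x \<in> space M. \<forall>k\<in>set ks. \<omega> x k}" .
  show ?thesis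
    unfolding eq[symmetric]
    by (rule law[unfolded determinantal_law_def, THEN conjunct2, THEN conjunct2, rule_format, OF assms])
qed

lemma fourier_0: "fourier_coeff (indicator I) 0 = of_real density"
  using circle_interval_borel[OF circle_interval] by (rule fourier_coeff_indicator_0)

lemma prob_occupied: "prob {x \<in> space M. \<omega> x k} = density"
proof -
  have "complex_of_real (prob {x \<in> space M. \<omega> x k}) = of_real density"
    using inclusion_prob[of "[k]"] fourier_0 by (simp add: det_single[simplified])
  then show ?thesis by simp
qed

text \<open>In the 2 by 2 determinant the off-diagonal entries are conjugate, so their product is a
  squared modulus.\<close>

lemma prob_occupied_pair:
  assumes "j \<noteq> k"
  shows "prob {x \<in> space M. \<omega> x j \<and> \<omega> x k} = density\<^sup>2 - (cmod (fourier_coeff (indicator I) (j - k)))\<^sup>2"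
proof -
  let ?K = "fourier_coeff (indicator I)"
  have "?K (k - j) = cnj (?K (j - k))" using fourier_coeff_uminus[of "indicator I" "j - k"] by simp
  then have "complex_of_real (prob {x \<in> space M. \<omega> x j \<and> \<omega> x k}) = of_real (density\<^sup>2) - ?K (j - k) * cnj (?K (j - k))"
    using inclusion_prob[of "[j, k]"] fourier_0 assms
    by (simp add: det_mat_2[simplified] numeral_2_eq_2 power2_eq_square)
  then have "complex_of_real (prob {x \<in> space M. \<omega> x j \<and> \<omega> x k}) = of_real (density\<^sup>2 - (cmod (?K (j - k)))\<^sup>2)"
    by (simp only: of_real_diff complex_norm_square)
  then show ?thesis by (simp only: of_real_eq_iff)
qed

definition centred :: "'a \<Rightarrow> int \<Rightarrow> real" where
  "centred x k = of_bool (\<omega> x k) - density"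

lemma measurable_centred [measurable]: "(\<lambda>x. centred x k) \<in> borel_measurable M"
  unfolding centred_def by measurable

lemma integrable_centred_mult: "integrable M (\<lambda>x. centred x j * centred x k)"
proof (rule integrable_const_bound[where B = "(1 + density) * (1 + density)"])
  have "\<bar>centred x i\<bar> \<le> 1 + density" for x i
    using measure_nonneg[of lborel I] by (auto simp: centred_def of_bool_def abs_if)
  then show "AE x in M. norm (centred x j * centred x k) \<le> (1 + density) * (1 + density)"
    by (auto simp: abs_mult intro!: mult_mono)
qed measurable

text \<open>Products of occupation indicators are again indicators. The case j = k fits the same
  formula because the coefficient at 0 is the density.\<close>

lemma covariance:
  "(\<integral>x. centred x j * centred x k \<partial>M)
    = density * of_bool (j = k) - (cmod (fourier_coeff (indicator I) (j - k)))\<^sup>2"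
proof -
  let ?A = "\<lambda>i. {x \<in> space M. \<omega> x i}" and ?B = "{x \<in> space M. \<omega> x j \<and> \<omega> x k}"
  have int: "integrable M (indicator E :: _ \<Rightarrow> real)" if "E \<in> events" for E
    using that by (simp add: emeasure_eq_measure)
  have ev: "?A i \<in> events" "?B \<in> events" for i
    by measurable
  have "(\<integral>x. centred x j * centred x k \<partial>M) = (\<integral>x. indicator ?B x - density * indicator (?A j) x
      - density * indicator (?A k) x + density\<^sup>2 \<partial>M)"
    by (intro Bochner_Integration.integral_cong)
       (auto simp: centred_def indicator_def power2_eq_square algebra_simps)
  also have "\<dots> = prob ?B - density * prob (?A j) - density * prob (?A k) + density\<^sup>2"
    using ev by (simp add: int prob_space)
  also have "\<dots> = prob ?B - density\<^sup>2"
    by (simp add: prob_occupied power2_eq_square)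
  also have "\<dots> = density * of_bool (j = k) - (cmod (fourier_coeff (indicator I) (j - k)))\<^sup>2"
    by (cases "j = k") (simp_all add: prob_occupied prob_occupied_pair fourier_0)
  finally show ?thesis .
qed

end

section \<open>Variance of linear statistics as a weighted L^2 norm\<close>

lemma norm_sum_cis_squared:
  fixes c :: "'b \<Rightarrow> real" and k :: "'b \<Rightarrow> int"
  shows "(cmod (\<Sum>p\<in>P. of_real (c p) * cis (2 * pi * of_int (k p) * t)))\<^sup>2
    = (\<Sum>p\<in>P. \<Sum>q\<in>P. c p * c q * cos (2 * pi * of_int (k p - k q) * t))"
  unfolding cmod_power2
  by (simp add: power2_eq_square sum_product sum.distrib[symmetric] cos_diff
      left_diff_distrib right_diff_distrib algebra_simps)

context circle_interval_process
begin

text \<open>Both squares expand into the same double sum, matched term by term through the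
  covariances. The map k may send several indices to one site, so double sums over pairs can be used
  as they are.\<close>

lemma variance_eq_integral:
  obtains b where "\<And>P :: 'b set. \<And>c k. finite P \<Longrightarrow>
    (\<integral>x. (\<Sum>p\<in>P. c p * centred x (k p))\<^sup>2 \<partial>M) =
    integral {0..1} (\<lambda>t. trapezoid b t * (cmod (\<Sum>p\<in>P. of_real (c p) * cis (2 * pi * of_int (k p) * t)))\<^sup>2)"
proof -
  obtain b where b: "\<And>k::int. ((\<lambda>t. trapezoid b t * cos (2 * pi * of_int k * t)) has_integral
    density * of_bool (k = 0) - (cmod (fourier_coeff (indicator I) k))\<^sup>2) {0..1}"
    by (rule covariance_eq_integral[OF circle_interval]) (rule that)
  show ?thesis
  proof (rule that)
    fix P :: "'b set" and c k
    assume "finite P"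
    have "((\<lambda>t. \<Sum>p\<in>P. \<Sum>q\<in>P. c p * c q * (trapezoid b t * cos (2 * pi * of_int (k p - k q) * t))) has_integral
      (\<Sum>p\<in>P. \<Sum>q\<in>P. c p * c q * (\<integral>x. centred x (k p) * centred x (k q) \<partial>M))) {0..1}"
      unfolding covariance
      \<comment> \<open>The substitution turns k p = k q into k p - k q = 0, the form in which b is
        given.\<close>
      by (intro has_integral_sum has_integral_mult_right \<open>finite P\<close>) (subst eq_iff_diff_eq_0, rule b)
    moreover have "(\<integral>x. (\<Sum>p\<in>P. c p * centred x (k p))\<^sup>2 \<partial>M)
      = (\<integral>x. (\<Sum>p\<in>P. \<Sum>q\<in>P. c p * c q * (centred x (k p) * centred x (k q))) \<partial>M)"
      by (simp add: power2_eq_square sum_product mult_ac)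
    moreover have "\<dots> = (\<Sum>p\<in>P. \<Sum>q\<in>P. c p * c q * (\<integral>x. centred x (k p) * centred x (k q) \<partial>M))"
      by (simp add: integrable_centred_mult)
    ultimately show "(\<integral>x. (\<Sum>p\<in>P. c p * centred x (k p))\<^sup>2 \<partial>M) =
      integral {0..1} (\<lambda>t. trapezoid b t * (cmod (\<Sum>p\<in>P. of_real (c p) * cis (2 * pi * of_int (k p) * t)))\<^sup>2)"
      unfolding norm_sum_cis_squared
      by (simp add: integral_unique sum_distrib_left mult_ac)
  qed
qed

end

text \<open>For m > 0, the linear functional whose symbol is the average of
  \<open>fejer (4 ^ i)\<close> over i < m: the i-th term weights site k by 1 - |k| / 4^i as long as
  |k| < 4^i.\<close>

definition fejer_stat :: "nat \<Rightarrow> (int \<Rightarrow> real) \<Rightarrow> real" where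
  "fejer_stat m z = (\<Sum>i<m. (\<Sum>u<4^i. \<Sum>v<4^i. z (int u - int v)) / 4 ^ i) / real m"

text \<open>The diagonal u = v consists of 4^i pairs, so each averaged kernel gives the origin
  weight exactly 1.\<close>

lemma fejer_stat_remove_origin:
  assumes "0 < m"
  shows "fejer_stat m z = z 0 + fejer_stat m (z(0 := 0))"
proof -
  have "(\<Sum>u<4^i. \<Sum>v<4^i. z (int u - int v))
      = 4 ^ i * z 0 + (\<Sum>u<4^i. \<Sum>v<4^i. (z(0 := 0)) (int u - int v))" for i :: nat
  proof -
    have "(\<Sum>u<4^i. \<Sum>v<4^i. z (int u - int v))
      = (\<Sum>u<4^i. \<Sum>v<4^i. (if u = v then z 0 else 0) + (z(0 := 0)) (int u - int v))"
      by (intro sum.cong) auto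
    then show ?thesis by (simp add: sum.distrib)
  qed
  then show ?thesis
    using assms by (simp add: fejer_stat_def add_divide_distrib sum.distrib)
qed

section \<open>Almost sure recovery of the origin from the other sites\<close>

context circle_interval_process
begin

lemma second_moment_fejer_stat_le: "(\<integral>x. (fejer_stat m (centred x))\<^sup>2 \<partial>M) \<le> 3 / real m"
proof -
  obtain b where b: "\<And>P :: (nat \<times> nat \<times> nat) set. \<And>c k. finite P \<Longrightarrow>
    (\<integral>x. (\<Sum>p\<in>P. c p * centred x (k p))\<^sup>2 \<partial>M) =
    integral {0..1} (\<lambda>t. trapezoid b t * (cmod (\<Sum>p\<in>P. of_real (c p) * cis (2 * pi * of_int (k p) * t)))\<^sup>2)"
    by (rule variance_eq_integral) (rule that)
  \<comment> \<open>A triple (i, u, v) stands for one summand of the statistic, so its symbol is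
    literally the average of the double sums in \<open>fejer_eq_sum_cis\<close>.\<close>
  define P where "P = (SIGMA i:{..<m}. {..<(4::nat)^i} \<times> {..<(4::nat)^i})"
  define c :: "nat \<times> nat \<times> nat \<Rightarrow> real" where "c = (\<lambda>(i, u, v). 1 / (4 ^ i * real m))"
  define k :: "nat \<times> nat \<times> nat \<Rightarrow> int" where "k = (\<lambda>(i, u, v). int u - int v)"
  have "finite P" by (simp add: P_def)
  have sum_P: "(\<Sum>p\<in>P. h p) = (\<Sum>i<m. \<Sum>u<4^i. \<Sum>v<4^i. h (i, u, v))" for h :: "_ \<Rightarrow> 'c::comm_monoid_add"
    unfolding P_def by (simp add: sum.Sigma sum.cartesian_product)
  have "fejer_stat m (centred x) = (\<Sum>p\<in>P. c p * centred x (k p))" for x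
    by (simp add: sum_P c_def k_def fejer_stat_def sum_divide_distrib)
  moreover have "(cmod (\<Sum>p\<in>P. of_real (c p) * cis (2 * pi * of_int (k p) * t)))\<^sup>2
      = ((\<Sum>i<m. fejer (4 ^ i) t) / real m)\<^sup>2" for t
  proof -
    have "(\<Sum>p\<in>P. of_real (c p) * cis (2 * pi * of_int (k p) * t))
        = of_real ((\<Sum>i<m. fejer (4 ^ i) t) / real m)"
      by (simp add: sum_P c_def k_def fejer_eq_sum_cis sum_divide_distrib)
    then show ?thesis by (simp only: norm_of_real power2_abs)
  qed
  ultimately have "(\<integral>x. (fejer_stat m (centred x))\<^sup>2 \<partial>M)
      = integral {0..1} (\<lambda>t. trapezoid b t * ((\<Sum>i<m. fejer (4 ^ i) t) / real m)\<^sup>2)"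
    using b[OF \<open>finite P\<close>, of c k] by simp
  also have "\<dots> \<le> 3 / real m"
    unfolding trapezoid_def by (intro integral_fejer_average_le continuous_intros) auto
  finally show ?thesis .
qed

text \<open>The second moments are at most 3/m, so the squares tend to 0 in L^1 and a subsequence of
  them almost surely.\<close>

lemma AE_fejer_stat_tendsto_0:
  "\<exists>r. strict_mono r \<and> (AE x in M. (\<lambda>n. fejer_stat (r n) (centred x)) \<longlonglongrightarrow> 0)"
proof -
  have eq: "(fejer_stat m (centred x))\<^sup>2 = (\<Sum>i<m. \<Sum>j<m. \<Sum>u<4^i. \<Sum>u'<4^j. \<Sum>v<4^i. \<Sum>v'<4^j.
    centred x (int u - int v) * centred x (int u' - int v') / (4 ^ i * 4 ^ j * (real m)\<^sup>2))" for x m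
    by (simp add: fejer_stat_def power_divide power2_eq_square sum_product sum_divide_distrib mult_ac)
  have "integrable M (\<lambda>x. (fejer_stat m (centred x))\<^sup>2)" for m
    unfolding eq by (intro Bochner_Integration.integrable_sum integrable_divide integrable_centred_mult)
  moreover have "(\<lambda>m. \<integral>x. norm ((fejer_stat m (centred x))\<^sup>2) \<partial>M) \<longlonglongrightarrow> 0"
  proof (rule tendsto_sandwich[of "\<lambda>_. 0"])
    show "(\<lambda>m. 3 / real m) \<longlonglongrightarrow> 0" by (rule lim_const_over_n)
  qed (auto simp: second_moment_fejer_stat_le intro!: always_eventually Bochner_Integration.integral_nonneg)
  ultimately obtain r where "strict_mono r"
    and r: "AE x in M. (\<lambda>n. (fejer_stat (r n) (centred x))\<^sup>2) \<longlonglongrightarrow> 0"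
    using tendsto_L1_AE_subseq[of M "\<lambda>m x. (fejer_stat m (centred x))\<^sup>2"] by blast
  from r have "AE x in M. (\<lambda>n. fejer_stat (r n) (centred x)) \<longlonglongrightarrow> 0"
  proof eventually_elim
    case (elim x)
    then show ?case using tendsto_real_sqrt[OF elim] by (simp add: tendsto_rabs_zero_iff)
  qed
  with \<open>strict_mono r\<close> show ?thesis by blast
qed

lemma origin_determined:
  "\<exists>N :: (int \<Rightarrow> bool) \<Rightarrow> nat. N \<in> config_space (UNIV - {0}) \<rightarrow>\<^sub>M count_space UNIV \<and>
    (AE x in M. of_bool (\<omega> x 0) = N (out_config (\<omega> x)))"
proof -
  obtain r where "strict_mono r" and r: "AE x in M. (\<lambda>n. fejer_stat (r n) (centred x)) \<longlonglongrightarrow> 0"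
    using AE_fejer_stat_tendsto_0 by blast
  define W :: "nat \<Rightarrow> (int \<Rightarrow> bool) \<Rightarrow> real" where
    "W m \<eta> = fejer_stat m ((\<lambda>k. of_bool (\<eta> k) - density)(0 := 0))" for m \<eta>
  \<comment> \<open>Almost surely \<omega>(0) - density + \<open>W\<close> tends to 0 along the
    subsequence, so the limit taken here is \<omega>(0). As \<open>lim\<close> is total, N is
    defined and measurable also where the sequence diverges.\<close>
  define N :: "(int \<Rightarrow> bool) \<Rightarrow> nat" where "N \<eta> = of_bool (lim (\<lambda>n. density - W (r n) \<eta>) = 1)" for \<eta>
  let ?S = "config_space (UNIV - {0})"
  have coord: "(\<lambda>\<eta>. ((\<lambda>k. of_bool (\<eta> k) - density)(0 := 0)) k) \<in> borel_measurable ?S" for k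
  proof (cases "k = 0")
    case False
    then have [measurable]: "(\<lambda>\<eta>. \<eta> k) \<in> ?S \<rightarrow>\<^sub>M count_space UNIV"
      unfolding config_space_def by (intro measurable_component_singleton) simp
    show ?thesis using False by simp
  qed simp
  have [measurable]: "W m \<in> borel_measurable ?S" for m
    unfolding W_def[abs_def] fejer_stat_def
    by (intro borel_measurable_divide borel_measurable_sum coord) simp_all
  have N: "N \<in> ?S \<rightarrow>\<^sub>M count_space UNIV"
    unfolding N_def[abs_def] by measurable
  have "AE x in M. of_bool (\<omega> x 0) = N (out_config (\<omega> x))"
    using r
  proof eventually_elim
    case (elim x)
    have W: "fejer_stat m (centred x) = of_bool (\<omega> x 0) - density + W m (out_config (\<omega> x))" if "0 < m" for m
    proof -
      \<comment> \<open>Resetting both functions at the origin hides the \<open>undefined\<close>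
        value that \<open>restrict\<close> puts there.\<close>
      have "(centred x)(0 := 0) = (\<lambda>k. of_bool (out_config (\<omega> x) k) - density)(0 := 0)"
        by (auto simp: fun_eq_iff centred_def out_config_def)
      then show ?thesis using fejer_stat_remove_origin[OF that, of "centred x"]
        by (simp add: W_def centred_def)
    qed
    \<comment> \<open>The origin has weight 1 only for positive index; n > 0 ensures this since r n
      is at least n.\<close>
    have "\<forall>\<^sub>F n in sequentially. of_bool (\<omega> x 0) - fejer_stat (r n) (centred x) = density - W (r n) (out_config (\<omega> x))"
      using eventually_gt_at_top[of 0]
    proof eventually_elim
      case (elim n)
      then have "0 < r n" using seq_suble[OF \<open>strict_mono r\<close>, of n] by simp
      then show ?case using W by simp
    qed
    moreover have "(\<lambda>n. of_bool (\<omega> x 0) - fejer_stat (r n) (centred x)) \<longlonglongrightarrow> of_bool (\<omega> x 0) - 0"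
      by (intro tendsto_intros elim)
    ultimately have "(\<lambda>n. density - W (r n) (out_config (\<omega> x))) \<longlonglongrightarrow> of_bool (\<omega> x 0)"
      using Lim_transform_eventually by fastforce
    then have "lim (\<lambda>n. density - W (r n) (out_config (\<omega> x))) = of_bool (\<omega> x 0)"
      by (rule limI)
    then show ?case by (simp add: N_def)
  qed
  with N show ?thesis by blast
qed

end

subsection \<open>Conditional probabilities\<close>

text \<open>The indicator agrees almost surely with a function of Y, and conditional expectation
  given Y fixes such functions.\<close>

lemma (in prob_space) AE_cond_prob_given_eq_indicator:
  assumes Y: "Y \<in> M \<rightarrow>\<^sub>M S" and A: "A \<in> sets M" and h: "h \<in> borel_measurable S"
    and eq: "AE x in M. indicator A x = (h (Y x) :: real)"
  shows "AE x in M. cond_prob_given M Y S A x = indicator A x"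
proof -
  let ?F = "vimage_algebra (space M) Y S"
  have "sets ?F \<subseteq> sets M"
    using measurable_sets[OF Y] measurable_space[OF Y] by (subst sets_vimage_algebra2) auto
  then have "subalgebra M ?F" by (simp add: subalgebra_def)
  then interpret F: finite_measure_subalgebra M ?F by unfold_locales
  have hY: "(\<lambda>x. h (Y x)) \<in> borel_measurable ?F"
    by (intro measurable_compose[OF measurable_vimage_algebra1 h] funcsetI measurable_space[OF Y])
  have hYM: "(\<lambda>x. h (Y x)) \<in> borel_measurable M" by (rule measurable_compose[OF Y h])
  have indM: "(indicator A :: _ \<Rightarrow> real) \<in> borel_measurable M" using A by simp
  have "integrable M (\<lambda>x. h (Y x))"
    using integrable_cong_AE_imp[OF _ hYM, of "indicator A"] A eq
    by (simp add: integrable_indicator_iff emeasure_eq_measure eq_commute)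
  then have "AE x in M. real_cond_exp M ?F (\<lambda>x. h (Y x)) x = h (Y x)"
    using hY by (rule F.real_cond_exp_F_meas)
  moreover have "AE x in M. real_cond_exp M ?F (indicator A) x = real_cond_exp M ?F (\<lambda>x. h (Y x)) x"
    by (rule F.real_cond_exp_cong[OF eq indM hYM])
  ultimately show ?thesis
    using eq unfolding cond_prob_given_def by eventually_elim simp
qed

text \<open>An indicator vanishes exactly off its set, so the event is the complement of A up to a
  null set.\<close>

lemma (in prob_space) prob_cond_prob_given_eq_0:
  assumes "Y \<in> M \<rightarrow>\<^sub>M S" and A: "A \<in> sets M" and "h \<in> borel_measurable S"
    and "AE x in M. indicator A x = (h (Y x) :: real)"
  shows "prob {x \<in> space M. cond_prob_given M Y S A x = 0} = 1 - prob A"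
proof -
  have "prob {x \<in> space M. cond_prob_given M Y S A x = 0} = prob (space M - A)"
  proof (rule finite_measure_eq_AE)
    show "AE x in M. (x \<in> {x \<in> space M. cond_prob_given M Y S A x = 0}) = (x \<in> space M - A)"
      using AE_cond_prob_given_eq_indicator[OF assms] AE_space
      by eventually_elim (auto simp: indicator_def split: if_splits)
    have "cond_prob_given M Y S A \<in> borel_measurable M"
      unfolding cond_prob_given_def by (rule borel_measurable_cond_exp2)
    then show "{x \<in> space M. cond_prob_given M Y S A x = 0} \<in> sets M" by measurable
  qed (use A in auto)
  then show ?thesis using prob_compl[OF A] by simp
qed

text \<open>The two events have probabilities 1 - |I| and |I|, hence the condition 0 < |I| < 1 for
  positivity: a null or full arc leaves the origin almost surely empty or almost surely
  occupied.\<close>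

theorem theorem1p5:
  fixes M :: "'a measure" and \<omega> :: "'a \<Rightarrow> int \<Rightarrow> bool" and I :: "real set"
  assumes "circle_interval I"
    and "prob_space M"
    and "\<omega> \<in> M \<rightarrow>\<^sub>M config_space UNIV"
    and "determinantal_law (indicator I) (distr M (config_space UNIV) \<omega>)"
  shows "(\<exists>N :: (int \<Rightarrow> bool) \<Rightarrow> nat.
            N \<in> config_space (UNIV - {0}) \<rightarrow>\<^sub>M count_space UNIV \<and>
            (AE x in M. of_bool (\<omega> x 0) = N (out_config (\<omega> x)))) \<and>
         (0 < measure lborel I \<and> measure lborel I < 1 \<longrightarrow>
            measure M {x \<in> space M.
              cond_prob_given M (\<lambda>x. out_config (\<omega> x)) (config_space (UNIV - {0}))
                {y \<in> space M. \<omega> y 0} x = 0} > 0 \<and>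
            measure M {x \<in> space M.
              cond_prob_given M (\<lambda>x. out_config (\<omega> x)) (config_space (UNIV - {0}))
                {y \<in> space M. \<not> \<omega> y 0} x = 0} > 0)"
proof -
  interpret circle_interval_process M \<omega> I
    using assms by (simp add: circle_interval_process_def circle_interval_process_axioms_def)
  let ?S = "config_space (UNIV - {0})" and ?Y = "\<lambda>x. out_config (\<omega> x)"
  obtain N :: "_ \<Rightarrow> nat" where N: "N \<in> ?S \<rightarrow>\<^sub>M count_space UNIV" and eq: "AE x in M. of_bool (\<omega> x 0) = N (?Y x)"
    using origin_determined by blast
  have Y: "?Y \<in> M \<rightarrow>\<^sub>M ?S"
    using measurable_config unfolding out_config_def config_space_def
    by (rule measurable_compose[OF _ measurable_restrict_subset]) simp
  have hN: "(\<lambda>\<eta>. f (N \<eta>)) \<in> borel_measurable ?S" for f :: "nat \<Rightarrow> real"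
    by (rule measurable_compose[OF N]) simp
  have "prob {x \<in> space M. cond_prob_given M ?Y ?S {y \<in> space M. \<omega> y 0} x = 0}
      = 1 - prob {y \<in> space M. \<omega> y 0}"
  proof (rule prob_cond_prob_given_eq_0[OF Y _ hN[of real]])
    show "AE x in M. indicator {y \<in> space M. \<omega> y 0} x = real (N (?Y x))"
      using eq AE_space by eventually_elim (auto simp: indicator_def of_bool_def split: if_splits)
  qed measurable
  moreover have "prob {x \<in> space M. cond_prob_given M ?Y ?S {y \<in> space M. \<not> \<omega> y 0} x = 0}
      = 1 - prob {y \<in> space M. \<not> \<omega> y 0}"
  \<comment> \<open>Vacancy of the origin is read off the outside configuration as 1 - N.\<close>
  proof (rule prob_cond_prob_given_eq_0[OF Y _ hN[of "\<lambda>n. 1 - real n"]])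
    show "AE x in M. indicator {y \<in> space M. \<not> \<omega> y 0} x = 1 - real (N (?Y x))"
      using eq AE_space by eventually_elim (auto simp: indicator_def of_bool_def split: if_splits)
  qed measurable
  moreover have "prob {y \<in> space M. \<not> \<omega> y 0} = 1 - density"
    using prob_neg[of "\<lambda>y. \<omega> y 0"] prob_occupied[of 0] by simp
  ultimately show ?thesis
    using origin_determined prob_occupied[of 0] by simp
qed

end
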